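(* (i) Let $\mathrm{Ad}:G^J(\mathbb{R})\times\mathfrak{g}^J\to\mathfrak{g}^J$ be the adjoint representation of the Jacobi group $G^J(\mathbb{R})$. Then $$\mathrm{Ad}(M,X,\kappa)\cdot(A,\xi,r)=\big(MAM^{-1},\,XAM^{-1}+\xi M^{-1},\,r-2\Omega(\xi,X)-\Omega(XA,X)\big),$$ where $M\in\mathrm{SL}(2,\mathbb{R})$, $A\in\mathfrak{sl}(2,\mathbb{R})$, $X,\xi\in\mathbb{R}^2$ and $\kappa,r\in\mathbb{R}$. (ii) For $k(x)\in\mathfrak{a}$ and $g\in G^J(\mathbb{R})$: $\mathrm{Ad}(g)k(x)\in\mathfrak{a}$ if and only if $g\in B$ or $k(x)$ is a constant polynomial. In particular, $\mathrm{Ad}(b)\mathfrak{a}\subseteq\mathfrak{a}$ for all $b\in B$. Moreover, if $k(x)$ is a constant polynomial, then $\mathrm{Ad}(g)k(x)=k(x)$ for all $g\in G^J(\mathbb{R})$. (iii) For $b\in B$ and $k(x)\in\mathfrak{a}$, $\mathrm{Ad}(b)k(x)=k(x\cdot b)$.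
   Context: The Jacobi group $G^J(\mathbb{R})$ is $\mathrm{SL}(2,\mathbb{R})\times\mathbb{R}^2\times\mathbb{R}$ with multiplication $(M_1,X_1,\kappa_1)\cdot(M_2,X_2,\kappa_2)=(M_1M_2,X_1M_2+X_2,\kappa_1+\kappa_2+\Omega(X_1M_2,X_2))$, where elements of $\mathbb{R}^2$ are row vectors and $\Omega(\xi,\eta)=\xi_1\eta_2-\xi_2\eta_1$. Its Lie algebra is $\mathfrak{g}^J=\mathfrak{sl}(2,\mathbb{R})\times\mathbb{R}^2\times\mathbb{R}$ with bracket $[(A,\xi,r),(B,\eta,s)]=([A,B],\xi B-\eta A,2\Omega(\xi,\eta))$. Let $F=\big(\big[\begin{smallmatrix}0&1\\0&0\end{smallmatrix}\big],0,0\big)$, $Q=(0,(0,1),0)$, $R=(0,0,1)\in\mathfrak{g}^J$ and $\mathfrak{a}=\mathrm{Vect}_{\mathbb{R}}\{F,Q,R\}$, identified with the space of real polynomials in $x$ of degree $\le2$ via $F\mapsto-x^2$, $Q\mapsto x$, $R\mapsto-\frac14$. The subgroup $B\subset G^J(\mathbb{R})$ is $$B=\Big\{\Big(\begin{bmatrix}a&b\\0&a^{-1}\end{bmatrix},(\lambda,\mu,\kappa)\Big)\ \Big|\ a,b,\lambda,\mu,\kappa\in\mathbb{R},\ a\ne0\Big\},$$ which acts on the right on $\mathbb{R}$ by $x\cdot\big(\big[\begin{smallmatrix}a&b\\0&a^{-1}\end{smallmatrix}\big],(\lambda,\mu,\kappa)\big)=ax-\frac{\lambda}{2}$. *)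

theory Defs
  imports
    "HOL-Analysis.Analysis"
    "HOL-Algebra.Group"
    "HOL-Computational_Algebra.Polynomial"
begin

section \<open>The Jacobi group\<close>

text \<open>Elements of \<^typ>\<open>real ^ 2\<close> are row vectors, so matrices act on them by \<^term>\<open>(v*)\<close>.\<close>

type_synonym jacobi = "(real ^ 2 ^ 2) \<times> (real ^ 2) \<times> real"

definition Omega :: "real ^ 2 \<Rightarrow> real ^ 2 \<Rightarrow> real" where
  "Omega \<xi> \<eta> = \<xi> $ 1 * \<eta> $ 2 - \<xi> $ 2 * \<eta> $ 1"

definition SL2 :: "(real ^ 2 ^ 2) set" where
  "SL2 = {M. det M = 1}"

definition sl2 :: "(real ^ 2 ^ 2) set" where
  "sl2 = {A. trace A = 0}"

fun jacobi_mult :: "jacobi \<Rightarrow> jacobi \<Rightarrow> jacobi" where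
  "jacobi_mult (M\<^sub>1, X\<^sub>1, \<kappa>\<^sub>1) (M\<^sub>2, X\<^sub>2, \<kappa>\<^sub>2) =
     (M\<^sub>1 ** M\<^sub>2, X\<^sub>1 v* M\<^sub>2 + X\<^sub>2, \<kappa>\<^sub>1 + \<kappa>\<^sub>2 + Omega (X\<^sub>1 v* M\<^sub>2) X\<^sub>2)"

definition GJ :: "jacobi monoid" where
  "GJ = \<lparr>carrier = SL2 \<times> UNIV \<times> UNIV, mult = jacobi_mult, one = (mat 1, 0, 0)\<rparr>"

definition gJ :: "jacobi set" where
  "gJ = sl2 \<times> UNIV \<times> UNIV"

lemma matrix_inv_mult_left: "matrix_inv M ** M = mat 1"
  if "invertible M" for M :: "real ^ 'n ^ 'n"
  using that someI_ex[of "\<lambda>M'. M ** M' = mat 1 \<and> M' ** M = mat 1"]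
  unfolding invertible_def matrix_inv_def by blast

lemma jacobi_mult_inverse:
  assumes "det M = 1"
  shows "jacobi_mult (matrix_inv M, - (X v* matrix_inv M), - \<kappa>) (M, X, \<kappa>) = (mat 1, 0, 0)"
proof -
  have "invertible M" using assms by (simp add: invertible_det_nz)
  then have "matrix_inv M ** M = mat 1" by (rule matrix_inv_mult_left)
  moreover have "(- (X v* matrix_inv M)) v* M = - X"
  proof -
    have "(- (X v* matrix_inv M)) v* M = - (X v* (matrix_inv M ** M))"
      by (metis vector_matrix_mul_assoc scaleR_minus1_left scaleR_vector_matrix_assoc)
    then show ?thesis using \<open>matrix_inv M ** M = mat 1\<close> by simp
  qed
  ultimately show ?thesis by (simp add: Omega_def)
qed

lemma group_GJ: "group GJ"
proof (rule groupI)
  show "x \<otimes>\<^bsub>GJ\<^esub> y \<in> carrier GJ" if "x \<in> carrier GJ" "y \<in> carrier GJ" for x y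
    using that by (cases x; cases y) (auto simp: GJ_def SL2_def det_mul)
next
  show "x \<otimes>\<^bsub>GJ\<^esub> y \<otimes>\<^bsub>GJ\<^esub> z = x \<otimes>\<^bsub>GJ\<^esub> (y \<otimes>\<^bsub>GJ\<^esub> z)"
    if "x \<in> carrier GJ" "y \<in> carrier GJ" "z \<in> carrier GJ" for x y z
  proof -
    obtain M1 X1 k1 where x: "x = (M1, X1, k1)" by (cases x)
    obtain M2 X2 k2 where y: "y = (M2, X2, k2)" by (cases y)
    obtain M3 X3 k3 where z: "z = (M3, X3, k3)" by (cases z)
    have "det M3 = 1" using that z by (auto simp: GJ_def SL2_def)
    then have "Omega (u v* M3) (v v* M3) = Omega u v" for u v
      unfolding Omega_def det_2 vector_matrix_mult_def by (simp add: sum_2) algebra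
    moreover have "Omega (u + v) w = Omega u w + Omega v w"
      "Omega w (u + v) = Omega w u + Omega w v" for u v w
      by (simp_all add: Omega_def algebra_simps)
    ultimately show ?thesis
      by (simp add: x y z GJ_def matrix_mul_assoc vector_matrix_mul_assoc[symmetric] vector_matrix_left_distrib del: vector_matrix_mul_assoc)
  qed
next
  show "\<one>\<^bsub>GJ\<^esub> \<in> carrier GJ" by (simp add: GJ_def SL2_def)
next
  show "\<one>\<^bsub>GJ\<^esub> \<otimes>\<^bsub>GJ\<^esub> x = x" for x
    by (cases x) (simp add: GJ_def Omega_def)
next
  show "\<exists>y\<in>carrier GJ. y \<otimes>\<^bsub>GJ\<^esub> x = \<one>\<^bsub>GJ\<^esub>" if "x \<in> carrier GJ" for x
  proof -
    obtain M X k where x: "x = (M, X, k)" by (cases x)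
    have d: "det M = 1" using that by (simp add: x GJ_def SL2_def)
    then have "invertible M" by (simp add: invertible_det_nz)
    then have "det (matrix_inv M) * det M = 1" by (metis det_I det_mul matrix_inv_mult_left)
    then have "(matrix_inv M, - (X v* matrix_inv M), - k) \<in> carrier GJ"
      using d by (simp add: GJ_def SL2_def)
    then show ?thesis using jacobi_mult_inverse[OF d]
      by (metis x GJ_def monoid.select_convs(1,2) partial_object.select_convs(1))
  qed
qed


section \<open>The adjoint representation\<close>

text \<open>The Lie algebra \<^term>\<open>gJ\<close> is the tangent space at the identity of \<^term>\<open>GJ\<close>, viewed as
  a submanifold of the vector space \<^typ>\<open>jacobi\<close>; a tangent vector is the velocity of a curve
  in \<^term>\<open>GJ\<close> through the identity. \<open>Ad g\<close> is the differential at the identity of the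
  conjugation \<open>h \<mapsto> g h g\<inverse>\<close>: it maps the velocity of a curve to the velocity of the
  conjugated curve.\<close>

definition curve_through_one :: "(real \<Rightarrow> jacobi) \<Rightarrow> jacobi \<Rightarrow> bool" where
  "curve_through_one c Z \<longleftrightarrow>
     (\<forall>t. c t \<in> carrier GJ) \<and> c 0 = \<one>\<^bsub>GJ\<^esub> \<and> (c has_vector_derivative Z) (at 0)"

lemma gJ_eq_velocities: "gJ = {Z. \<exists>c. curve_through_one c Z}"
proof (intro equalityI subsetI CollectI)
  fix Z assume "Z \<in> gJ"
  then obtain A \<xi> r where Z: "Z = (A, \<xi>, r)" and tr: "trace A = 0"
    by (auto simp: gJ_def sl2_def)
  define s where "s t = (1 + t\<^sup>2 * A $ 1 $ 2 * A $ 2 $ 1) / (1 + t * A $ 1 $ 1) - 1 + t * A $ 1 $ 1" for t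
  define E :: "real ^ 2 ^ 2" where "E = vector [vector [0, 0], vector [0, 1]]"
  define c0 :: "real \<Rightarrow> jacobi" where "c0 t = (mat 1 + t *\<^sub>R A + s t *\<^sub>R E, t *\<^sub>R \<xi>, t * r)" for t
  define U where "U = {t. 1 + t * A $ 1 $ 1 > 0}"
  define c where "c t = (if t \<in> U then c0 t else \<one>\<^bsub>GJ\<^esub>)" for t
  have A22: "A $ 2 $ 2 = - A $ 1 $ 1"
    using tr by (simp add: trace_def sum_2)
  have "det (mat 1 + t *\<^sub>R A + s t *\<^sub>R E) = 1" if "t \<in> U" for t
    using that by (simp add: det_2 mat_def E_def vector_2 A22 s_def U_def power2_eq_square field_simps)
  then have "c t \<in> carrier GJ" for t
    by (simp add: c_def c0_def GJ_def SL2_def)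
  moreover have "c 0 = \<one>\<^bsub>GJ\<^esub>"
    by (simp add: c_def c0_def s_def GJ_def)
  moreover have "(c has_vector_derivative Z) (at 0)"
  proof -
    have "(s has_real_derivative 0) (at 0)"
      unfolding s_def by (auto intro!: derivative_eq_intros)
    then have s': "(s has_derivative (\<lambda>h. 0)) (at 0)"
      by (simp add: has_field_derivative_def lambda_zero)
    have "(c0 has_vector_derivative Z) (at 0)"
      unfolding c0_def Z has_vector_derivative_def
      by (auto intro!: derivative_eq_intros s')
    moreover have "open U"
      unfolding U_def by (intro open_Collect_less continuous_intros)
    ultimately show ?thesis
      by (rule has_vector_derivative_transform_within_open[where S = U])
        (auto simp: U_def c_def)
  qed
  ultimately show "\<exists>c. curve_through_one c Z"
    unfolding curve_through_one_def by blast
next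
  fix Z assume "Z \<in> {Z. \<exists>c. curve_through_one c Z}"
  then obtain c where c: "\<And>t. c t \<in> carrier GJ" "c 0 = \<one>\<^bsub>GJ\<^esub>" "(c has_vector_derivative Z) (at 0)"
    unfolding curve_through_one_def by blast
  have d: "((\<lambda>t. fst (c t) $ i $ j) has_real_derivative fst Z $ i $ j) (at 0)" for i j
    unfolding has_real_derivative_iff_has_vector_derivative
    by (intro bounded_linear.has_vector_derivative[OF bounded_linear_vec_nth]
        bounded_linear.has_vector_derivative[OF bounded_linear_fst] c(3))
  have "((\<lambda>t. det (fst (c t))) has_real_derivative fst Z $ 1 $ 1 + fst Z $ 2 $ 2) (at 0)"
    unfolding det_2 by (rule derivative_eq_intros d refl)+ (simp add: c(2) GJ_def mat_def)
  moreover have "det (fst (c t)) = 1" for t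
    using c(1)[of t] by (auto simp: GJ_def SL2_def)
  ultimately have "fst Z $ 1 $ 1 + fst Z $ 2 $ 2 = 0"
    using DERIV_unique[OF _ DERIV_const] by simp
  then show "Z \<in> gJ"
    by (cases Z) (simp add: gJ_def sl2_def trace_def sum_2)
qed

definition Ad :: "jacobi \<Rightarrow> jacobi \<Rightarrow> jacobi" where
  "Ad g Z = (THE W. \<forall>c. curve_through_one c Z \<longrightarrow>
     ((\<lambda>t. g \<otimes>\<^bsub>GJ\<^esub> c t \<otimes>\<^bsub>GJ\<^esub> inv\<^bsub>GJ\<^esub> g) has_vector_derivative W) (at 0))"


section \<open>The subspace of quadratic polynomials and the subgroup acting on it\<close>

definition FJ :: jacobi where
  "FJ = (vector [vector [0, 1], vector [0, 0]], 0, 0)"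

definition QJ :: jacobi where
  "QJ = (0, vector [0, 1], 0)"

definition RJ :: jacobi where
  "RJ = (0, 0, 1)"

definition aJ :: "jacobi set" where
  "aJ = span {FJ, QJ, RJ}"

text \<open>The identification of \<^term>\<open>aJ\<close> with the polynomials of degree at most 2. On \<^term>\<open>aJ\<close>
  the three coordinates read off below are those with respect to \<^term>\<open>FJ\<close>, \<^term>\<open>QJ\<close>,
  \<^term>\<open>RJ\<close>; outside \<^term>\<open>aJ\<close> the function has no meaning.\<close>

fun poly_of :: "jacobi \<Rightarrow> real poly" where
  "poly_of (A, \<xi>, r) =
     smult (A $ 1 $ 2) (- monom 1 2) + smult (\<xi> $ 2) (monom 1 1) + smult r [:- 1/4:]"

lemma poly_of_combination:
  "poly_of (u *\<^sub>R FJ + v *\<^sub>R QJ + w *\<^sub>R RJ) =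
     smult u (- monom 1 2) + smult v (monom 1 1) + smult w [:- 1/4:]"
  by (simp add: FJ_def QJ_def RJ_def vector_2)

lemma aJ_eq: "aJ = {u *\<^sub>R FJ + v *\<^sub>R QJ + w *\<^sub>R RJ | u v w. True}"
proof -
  have "x \<in> aJ \<longleftrightarrow> (\<exists>u v w. x = u *\<^sub>R FJ + v *\<^sub>R QJ + w *\<^sub>R RJ)" for x
    unfolding aJ_def span_breakdown_eq span_empty
    by (simp add: algebra_simps)
  then show ?thesis by blast
qed

lemma bij_betw_poly_of: "bij_betw poly_of aJ {p. degree p \<le> 2}"
proof (rule bij_betw_byWitness[where f' = "\<lambda>p. (- coeff p 2) *\<^sub>R FJ + coeff p 1 *\<^sub>R QJ + (- 4 * coeff p 0) *\<^sub>R RJ"])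
  show "\<forall>x\<in>aJ. (- coeff (poly_of x) 2) *\<^sub>R FJ + coeff (poly_of x) 1 *\<^sub>R QJ
      + (- 4 * coeff (poly_of x) 0) *\<^sub>R RJ = x"
    by (auto simp: aJ_eq poly_of_combination numeral_2_eq_2 simp del: poly_of.simps)
next
  show "\<forall>p\<in>{p. degree p \<le> 2}. poly_of ((- coeff p 2) *\<^sub>R FJ + coeff p 1 *\<^sub>R QJ
      + (- 4 * coeff p 0) *\<^sub>R RJ) = p"
  proof safe
    fix p :: "real poly" assume "degree p \<le> 2"
    then have "p = [:coeff p 0, coeff p 1, coeff p 2:]"
      by (auto simp: poly_eq_iff coeff_pCons coeff_eq_0 numeral_2_eq_2 split: nat.split)
    then show "poly_of ((- coeff p 2) *\<^sub>R FJ + coeff p 1 *\<^sub>R QJ + (- 4 * coeff p 0) *\<^sub>R RJ) = p"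
      unfolding poly_of_combination
      by (simp add: monom_altdef power2_eq_square flip: one_pCons)
  qed
next
  have "degree (poly_of (A, \<xi>, r)) \<le> 2" for A \<xi> r
    unfolding poly_of.simps
    by (intro degree_add_le degree_smult_le[THEN order_trans])
      (simp_all add: degree_monom_le[THEN order_trans])
  then show "poly_of ` aJ \<subseteq> {p. degree p \<le> 2}"
    by auto
next
  show "(\<lambda>p. (- coeff p 2) *\<^sub>R FJ + coeff p 1 *\<^sub>R QJ + (- 4 * coeff p 0) *\<^sub>R RJ)
      ` {p. degree p \<le> 2} \<subseteq> aJ"
    unfolding aJ_eq by blast
qed

definition BJ :: "jacobi set" where
  "BJ = {(vector [vector [a, b], vector [0, inverse a]], vector [l, m], \<kappa>) | a b l m \<kappa>. a \<noteq> 0}"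

text \<open>The right action of \<^term>\<open>BJ\<close> on the real line; only meaningful for elements of \<^term>\<open>BJ\<close>.\<close>

fun act :: "real \<Rightarrow> jacobi \<Rightarrow> real" where
  "act x (M, X, \<kappa>) = M $ 1 $ 1 * x - X $ 1 / 2"

end

theory Submission
  imports Defs
begin

text \<open>Conjugation in the group is explicit (\<open>conjugation_GJ\<close>): in the point (N,
  Y, s) near the identity it is affine except for the bilinear term Omega(XN, Y). Differentiating
  along a curve with N(0) = 1 and Y(0) = 0 gives formula (i) (\<open>Ad_eq\<close>). For k = uF + vQ
  + wR the formula becomes explicit entries (\<open>Ad_combination\<close>). The entries that must
  vanish in \<open>aJ\<close> all carry the factor c = \<open>M $ 2 $ 1\<close>, and together they
  vanish iff c = 0, which says g lies in B, or u = v = 0, which says k is constant. The remaining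
  entries are, under the identification with polynomials, the coefficients of k(ax - X1/2) with a =
  \<open>M $ 1 $ 1\<close>.\<close>

text \<open>Supplies the product rule for Omega along a curve.\<close>

lemma bounded_bilinear_Omega: "bounded_bilinear Omega"
  unfolding bilinear_conv_bounded_bilinear[symmetric] bilinear_def
  by (auto intro!: linearI simp: Omega_def algebra_simps)

text \<open>Omega is the determinant of the matrix with the two given rows, so multiplying both rows
  by M scales it by det M = 1.\<close>

lemma Omega_v_mult_SL2: "M \<in> SL2 \<Longrightarrow> Omega (u v* M) (v v* M) = Omega u v"
  unfolding SL2_def Omega_def det_2 vector_matrix_mult_def mem_Collect_eq
  by (simp add: sum_2) algebra

text \<open>The inverse is the adjugate divided by the determinant 1. Having it entrywise makes the
  later computations polynomial in the entries of M.\<close>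

lemma matrix_inv_SL2:
  assumes "M \<in> SL2"
  shows "matrix_inv M = vector [vector [M $ 2 $ 2, - M $ 1 $ 2], vector [- M $ 2 $ 1, M $ 1 $ 1]]"
    (is "_ = ?N")
proof -
  have d: "M $ 1 $ 1 * M $ 2 $ 2 - M $ 1 $ 2 * M $ 2 $ 1 = 1"
    using assms by (simp add: SL2_def det_2)
  then have right: "M ** ?N = mat 1"
    by (simp add: vec_eq_iff forall_2 matrix_matrix_mult_def sum_2 mat_def algebra_simps)
  have "invertible M"
    using assms by (simp add: SL2_def invertible_det_nz)
  then have "matrix_inv M ** M = mat 1"
    by (rule matrix_inv_mult_left)
  then have "matrix_inv M ** (M ** ?N) = ?N"
    by (simp add: matrix_mul_assoc)
  with right show ?thesis
    by simp
qed

lemma matrix_inv_in_SL2: "M \<in> SL2 \<Longrightarrow> matrix_inv M \<in> SL2"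
  by (simp add: matrix_inv_SL2) (simp add: SL2_def det_2 algebra_simps)

lemma inv_GJ:
  assumes "M \<in> SL2"
  shows "inv\<^bsub>GJ\<^esub> (M, X, \<kappa>) = (matrix_inv M, - (X v* matrix_inv M), - \<kappa>)"
proof (rule group.inv_equality[OF group_GJ])
  show "(matrix_inv M, - (X v* matrix_inv M), - \<kappa>) \<otimes>\<^bsub>GJ\<^esub> (M, X, \<kappa>) = \<one>\<^bsub>GJ\<^esub>"
    using assms jacobi_mult_inverse[of M X \<kappa>] by (simp add: GJ_def SL2_def)
qed (use assms matrix_inv_in_SL2 in \<open>auto simp: GJ_def\<close>)

text \<open>The central parts \<kappa> and -\<kappa> cancel, and invariance of Omega under
  \<open>matrix_inv M\<close> removes that factor from the Omega term of the second product.\<close>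

lemma conjugation_GJ:
  assumes "M \<in> SL2"
  shows "(M, X, \<kappa>) \<otimes>\<^bsub>GJ\<^esub> (N, Y, s) \<otimes>\<^bsub>GJ\<^esub> inv\<^bsub>GJ\<^esub> (M, X, \<kappa>) =
    (M ** N ** matrix_inv M, (X v* N + Y - X) v* matrix_inv M,
     s + Omega (X v* N) Y - Omega (X v* N + Y) X)"
proof -
  have neg: "- (u v* K) = (- u) v* K" for u :: "real ^ 2" and K :: "real ^ 2 ^ 2"
    by (metis scaleR_minus1_left scaleR_vector_matrix_assoc)
  have "Omega u (- v) = - Omega u v" for u v
    by (simp add: Omega_def)
  then show ?thesis
    unfolding inv_GJ[OF assms] neg
    using Omega_v_mult_SL2[OF matrix_inv_in_SL2[OF assms]]
    by (simp add: GJ_def vector_matrix_left_distrib[symmetric])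
qed

lemma conjugated_curve_has_derivative:
  assumes M: "M \<in> SL2" and c: "curve_through_one c (A, \<xi>, r)"
  shows "((\<lambda>t. (M, X, \<kappa>) \<otimes>\<^bsub>GJ\<^esub> c t \<otimes>\<^bsub>GJ\<^esub> inv\<^bsub>GJ\<^esub> (M, X, \<kappa>)) has_vector_derivative
    (M ** A ** matrix_inv M, X v* A v* matrix_inv M + \<xi> v* matrix_inv M,
     r - 2 * Omega \<xi> X - Omega (X v* A) X)) (at 0)"
proof -
  define N where "N = (\<lambda>t. fst (c t))"
  define Y where "Y = (\<lambda>t. fst (snd (c t)))"
  define s where "s = (\<lambda>t. snd (snd (c t)))"
  have c': "(c has_vector_derivative (A, \<xi>, r)) (at 0)" and c0: "c 0 = (mat 1, 0, 0)"
    using c by (auto simp: curve_through_one_def GJ_def)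
  have N0: "N 0 = mat 1" and Y0: "Y 0 = 0"
    by (simp_all add: N_def Y_def c0)
  have sc: "((\<lambda>t. snd (c t)) has_vector_derivative (\<xi>, r)) (at 0)"
    using bounded_linear.has_vector_derivative[OF bounded_linear_snd c'] by simp
  have N': "(N has_vector_derivative A) (at 0)"
    using bounded_linear.has_vector_derivative[OF bounded_linear_fst c'] by (simp add: N_def)
  have Y': "(Y has_vector_derivative \<xi>) (at 0)"
    using bounded_linear.has_vector_derivative[OF bounded_linear_fst sc] by (simp add: Y_def)
  have s': "(s has_vector_derivative r) (at 0)"
    using bounded_linear.has_vector_derivative[OF bounded_linear_snd sc] by (simp add: s_def)
  have "bounded_linear (\<lambda>N. M ** N ** matrix_inv M)"
    unfolding linear_conv_bounded_linear[symmetric]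
    by (rule linearI)
      (simp_all add: matrix_matrix_mult_def vec_eq_iff sum_2 algebra_simps)
  then have conj': "((\<lambda>t. M ** N t ** matrix_inv M) has_vector_derivative M ** A ** matrix_inv M) (at 0)"
    by (rule bounded_linear.has_vector_derivative[OF _ N'])
  have lin_v: "bounded_linear (\<lambda>u. u v* K)" for K :: "real ^ 2 ^ 2"
    unfolding linear_conv_bounded_linear[symmetric]
    by (rule linearI) (simp_all add: vector_matrix_left_distrib scaleR_vector_matrix_assoc)
  have "bounded_linear (\<lambda>N. X v* N)"
    unfolding linear_conv_bounded_linear[symmetric]
    by (rule linearI)
      (simp_all add: vector_matrix_mult_def vec_eq_iff sum.distrib sum_distrib_left algebra_simps)
  then have XN': "((\<lambda>t. X v* N t) has_vector_derivative X v* A) (at 0)"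
    by (rule bounded_linear.has_vector_derivative[OF _ N'])
  \<comment> \<open>The \<open>0\<close> is the derivative of the constant X.\<close>
  have mid: "((\<lambda>t. (X v* N t + Y t - X) v* matrix_inv M) has_vector_derivative
      (X v* A + \<xi> - 0) v* matrix_inv M) (at 0)"
    by (intro bounded_linear.has_vector_derivative[OF lin_v] has_vector_derivative_diff
        has_vector_derivative_add XN' Y' has_vector_derivative_const)
  have "((\<lambda>t. s t + Omega (X v* N t) (Y t) - Omega (X v* N t + Y t) X) has_vector_derivative
      r + (Omega (X v* N 0) \<xi> + Omega (X v* A) (Y 0)) - Omega (X v* A + \<xi>) X) (at 0)"
    by (intro has_vector_derivative_diff has_vector_derivative_add s'
        bounded_bilinear.has_vector_derivative[OF bounded_bilinear_Omega] XN' Y'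
        bounded_linear.has_vector_derivative[OF bounded_bilinear.bounded_linear_left[OF bounded_bilinear_Omega]])
  \<comment> \<open>The factor 2: at the identity the product rule leaves Omega(X, \<xi>) =
    -Omega(\<xi>, X), which joins the -Omega(\<xi>, X) from the last term.\<close>
  moreover have "r + (Omega (X v* N 0) \<xi> + Omega (X v* A) (Y 0)) - Omega (X v* A + \<xi>) X =
      r - 2 * Omega \<xi> X - Omega (X v* A) X"
    by (simp add: N0 Y0 Omega_def algebra_simps)
  ultimately have last: "((\<lambda>t. s t + Omega (X v* N t) (Y t) - Omega (X v* N t + Y t) X)
      has_vector_derivative r - 2 * Omega \<xi> X - Omega (X v* A) X) (at 0)"
    by simp
  have "c t = (N t, Y t, s t)" for t
    by (simp add: N_def Y_def s_def)
  then show ?thesis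
    using has_vector_derivative_Pair[OF conj' has_vector_derivative_Pair[OF mid last]]
    by (simp add: conjugation_GJ[OF M] vector_matrix_left_distrib)
qed

text \<open>Every curve with the given velocity yields the same derivative. The description in
  \<open>Ad\<close> singles it out because at least one such curve exists, by
  \<open>gJ_eq_velocities\<close>; otherwise its condition would hold vacuously for every W.\<close>

lemma Ad_eq:
  assumes "M \<in> SL2" and "A \<in> sl2"
  shows "Ad (M, X, \<kappa>) (A, \<xi>, r) =
    (M ** A ** matrix_inv M, X v* A v* matrix_inv M + \<xi> v* matrix_inv M,
     r - 2 * Omega \<xi> X - Omega (X v* A) X)"
proof -
  have "(A, \<xi>, r) \<in> gJ"
    using assms(2) by (simp add: gJ_def)
  then obtain c where c: "curve_through_one c (A, \<xi>, r)"
    unfolding gJ_eq_velocities by blast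
  show ?thesis
    unfolding Ad_def
  proof (rule the_equality)
    fix W
    assume "\<forall>c. curve_through_one c (A, \<xi>, r) \<longrightarrow>
      ((\<lambda>t. (M, X, \<kappa>) \<otimes>\<^bsub>GJ\<^esub> c t \<otimes>\<^bsub>GJ\<^esub> inv\<^bsub>GJ\<^esub> (M, X, \<kappa>))
        has_vector_derivative W) (at 0)"
    then show "W = (M ** A ** matrix_inv M, X v* A v* matrix_inv M + \<xi> v* matrix_inv M,
        r - 2 * Omega \<xi> X - Omega (X v* A) X)"
      using vector_derivative_unique_at conjugated_curve_has_derivative[OF assms(1) c] c by metis
  qed (simp add: conjugated_curve_has_derivative[OF assms(1)])
qed

lemma combination_FQR:
  "u *\<^sub>R FJ + v *\<^sub>R QJ + w *\<^sub>R RJ = (vector [vector [0, u], vector [0, 0]], vector [0, v], w)"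
  by (simp add: FJ_def QJ_def RJ_def vec_eq_iff forall_2)

lemma aJ_iff:
  "(A, \<xi>, r) \<in> aJ \<longleftrightarrow> A $ 1 $ 1 = 0 \<and> A $ 2 $ 1 = 0 \<and> A $ 2 $ 2 = 0 \<and> \<xi> $ 1 = 0"
  by (auto simp: aJ_eq combination_FQR vec_eq_iff forall_2)

lemma poly_of_combination_pCons:
  "poly_of (u *\<^sub>R FJ + v *\<^sub>R QJ + w *\<^sub>R RJ) = [:- w / 4, v, - u:]"
  unfolding poly_of_combination
  by (simp add: monom_altdef power2_eq_square flip: one_pCons)

text \<open>When the lower left entry is 0, the determinant condition reads
  \<open>M $ 1 $ 1 * M $ 2 $ 2 = 1\<close>, which makes the diagonal entries inverse to each
  other.\<close>

lemma BJ_iff: "(M, X, \<kappa>) \<in> BJ \<longleftrightarrow> M \<in> SL2 \<and> M $ 2 $ 1 = 0"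
proof
  assume "(M, X, \<kappa>) \<in> BJ"
  then show "M \<in> SL2 \<and> M $ 2 $ 1 = 0"
    by (auto simp: BJ_def SL2_def det_2)
next
  assume "M \<in> SL2 \<and> M $ 2 $ 1 = 0"
  then have M21: "M $ 2 $ 1 = 0" and "M $ 1 $ 1 * M $ 2 $ 2 = 1"
    by (auto simp: SL2_def det_2)
  then have "M $ 1 $ 1 \<noteq> 0" and "M $ 2 $ 2 = inverse (M $ 1 $ 1)"
    by (auto simp: inverse_unique)
  moreover from this M21 have
    "M = vector [vector [M $ 1 $ 1, M $ 1 $ 2], vector [0, inverse (M $ 1 $ 1)]]"
    "X = vector [X $ 1, X $ 2]"
    by (simp_all add: vec_eq_iff forall_2)
  ultimately show "(M, X, \<kappa>) \<in> BJ"
    unfolding BJ_def by blast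
qed

lemma Ad_combination:
  assumes "M \<in> SL2"
  shows "Ad (M, X, \<kappa>) (u *\<^sub>R FJ + v *\<^sub>R QJ + w *\<^sub>R RJ) =
    (vector [vector [- u * M $ 1 $ 1 * M $ 2 $ 1, u * (M $ 1 $ 1)\<^sup>2],
             vector [- u * (M $ 2 $ 1)\<^sup>2, u * M $ 1 $ 1 * M $ 2 $ 1]],
     vector [- (v + u * X $ 1) * M $ 2 $ 1, (v + u * X $ 1) * M $ 1 $ 1],
     w + 2 * v * X $ 1 + u * (X $ 1)\<^sup>2)"
proof -
  \<comment> \<open>The trace condition under which \<open>Ad_eq\<close> applies.\<close>
  have "vector [vector [0, u], vector [0, 0]] \<in> sl2"
    by (simp add: sl2_def trace_def sum_2)
  then show ?thesis
    unfolding combination_FQR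
    by (simp add: Ad_eq[OF assms] matrix_inv_SL2[OF assms] vec_eq_iff forall_2
        matrix_matrix_mult_def vector_matrix_mult_def sum_2 Omega_def power2_eq_square algebra_simps)
qed

lemma Ad_in_aJ_iff:
  assumes "g \<in> carrier GJ" and "k \<in> aJ"
  shows "Ad g k \<in> aJ \<longleftrightarrow> g \<in> BJ \<or> degree (poly_of k) = 0"
proof -
  obtain M X \<kappa> where g: "g = (M, X, \<kappa>)" by (cases g)
  obtain u v w where k: "k = u *\<^sub>R FJ + v *\<^sub>R QJ + w *\<^sub>R RJ"
    using assms(2) by (auto simp: aJ_eq)
  have M: "M \<in> SL2" using assms(1) by (simp add: g GJ_def)
  have "degree (poly_of k) = 0 \<longleftrightarrow> u = 0 \<and> v = 0"
    by (auto simp: k poly_of_combination_pCons)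
  then show ?thesis
    \<comment> \<open>If c = \<open>M $ 2 $ 1\<close> is nonzero, the entry -u c^2 forces u = 0, and
      then the entry -(v + u X1) c forces v = 0.\<close>
    unfolding g BJ_iff unfolding k Ad_combination[OF M] aJ_iff
    by (auto simp: M)
qed

lemma Ad_constant:
  assumes "g \<in> carrier GJ" and "k \<in> aJ" and "degree (poly_of k) = 0"
  shows "Ad g k = k"
proof -
  obtain M X \<kappa> where g: "g = (M, X, \<kappa>)" by (cases g)
  obtain u v w where k: "k = u *\<^sub>R FJ + v *\<^sub>R QJ + w *\<^sub>R RJ"
    using assms(2) by (auto simp: aJ_eq)
  have M: "M \<in> SL2" using assms(1) by (simp add: g GJ_def)
  have "u = 0" "v = 0"
    using assms(3) by (auto simp: k poly_of_combination_pCons split: if_splits)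
  then show ?thesis
    unfolding g k Ad_combination[OF M] unfolding combination_FQR
    by (simp add: vec_eq_iff forall_2)
qed

text \<open>With k(x) = -u x^2 + v x - w/4, expanding k(ax - X1/2) gives the coefficients -u a^2, (v
  + u X1) a and -(w + 2 v X1 + u X1^2)/4, as read off from \<open>Ad_combination\<close>.\<close>

lemma poly_of_Ad_BJ:
  assumes "b \<in> BJ" and "k \<in> aJ"
  shows "poly (poly_of (Ad b k)) x = poly (poly_of k) (act x b)"
proof -
  obtain M X \<kappa> where b: "b = (M, X, \<kappa>)" by (cases b)
  obtain u v w where k: "k = u *\<^sub>R FJ + v *\<^sub>R QJ + w *\<^sub>R RJ"
    using assms(2) by (auto simp: aJ_eq)
  have M: "M \<in> SL2" using assms(1) by (simp add: b BJ_iff)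
  show ?thesis
    unfolding b k Ad_combination[OF M] poly_of_combination_pCons
    by (simp add: poly_monom power2_eq_square field_simps)
qed

theorem lemma3p49:
  shows "(\<forall>M\<in>SL2. \<forall>A\<in>sl2. \<forall>X \<xi> :: real ^ 2. \<forall>\<kappa> r :: real.
            Ad (M, X, \<kappa>) (A, \<xi>, r) =
              (M ** A ** matrix_inv M,
               X v* A v* matrix_inv M + \<xi> v* matrix_inv M,
               r - 2 * Omega \<xi> X - Omega (X v* A) X))
       \<and> (\<forall>k\<in>aJ. \<forall>g\<in>carrier GJ. Ad g k \<in> aJ \<longleftrightarrow> g \<in> BJ \<or> degree (poly_of k) = 0)
       \<and> (\<forall>b\<in>BJ. Ad b ` aJ \<subseteq> aJ)
       \<and> (\<forall>k\<in>aJ. degree (poly_of k) = 0 \<longrightarrow> (\<forall>g\<in>carrier GJ. Ad g k = k))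
       \<and> (\<forall>b\<in>BJ. \<forall>k\<in>aJ. \<forall>x :: real. poly (poly_of (Ad b k)) x = poly (poly_of k) (act x b))"
proof -
  \<comment> \<open>Lets \<open>Ad_in_aJ_iff\<close> apply to elements of B, which gives the
    invariance of \<open>aJ\<close>.\<close>
  have BJ_carrier: "b \<in> carrier GJ" if "b \<in> BJ" for b
    using that by (cases b) (simp add: BJ_iff GJ_def)
  show ?thesis
    by (intro conjI ballI allI impI image_subsetI)
      (simp_all add: Ad_eq Ad_in_aJ_iff Ad_constant poly_of_Ad_BJ BJ_carrier)
qed

end
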